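(* Let $$M^{[0,1]}=\mathrm{span}_{\mathbb F_2}\{v_{n,m}: n,m\ge0,\ m\equiv 0\text{ or }1\pmod 4\},\qquad M^{[2,3]}=\mathrm{span}_{\mathbb F_2}\{v_{n,m}: n,m\ge0,\ m\equiv 2\text{ or }3\pmod 4\}.$$ Then both $M^{[0,1]}$ and $M^{[2,3]}$ are $\mathcal A(1)$-submodules of $M$, and $$M=M^{[0,1]}\oplus M^{[2,3]}$$ as graded $\mathcal A(1)$-modules.
   Context: Let $M=\widetilde H^*(MO(2);\mathbb F_2)$ be the reduced mod $2$ cohomology of the Thom space $MO(2)$ of the universal real two-plane bundle. Write $S=H^*(BO(2);\mathbb F_2)=\mathbb F_2[w_1,w_2]$ with $|w_1|=1$, $|w_2|=2$ (Stiefel--Whitney classes; by the splitting principle $S=\mathbb F_2[x,y]^{\mathfrak S_2}$ with $w_1=x+y$, $w_2=xy$, $|x|=|y|=1$). Then $M=uS$ is free over $S$ on the Thom class $u$ of degree $2$, and the Steenrod squares act on $M$ by the Cartan formula, the usual action on $S$, and the Thom identity $\mathrm{Sq}(u)=u(1+w_1+w_2)$ for the total square $\mathrm{Sq}=\sum_k \mathrm{Sq}^k$. For $n,m\ge 0$ let $v_{n,m}=u\,w_1^n w_2^m$; these form an $\mathbb F_2$-basis of $M$. $\mathcal A(1)$ is the subalgebra of the mod $2$ Steenrod algebra generated by $\mathrm{Sq}^1$ and $\mathrm{Sq}^2$. *)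

theory Defs
  imports
    "HOL-Library.Z2"
    "HOL-Library.Poly_Mapping"
    "HOL-Computational_Algebra.Polynomial"
begin

section \<open>The mod 2 Steenrod algebra\<close>

text \<open>
  Words in the symbols Sq^0, Sq^1, Sq^2, ...: the list [i, j, ...] stands for Sq^i Sq^j ....
  The monoid algebra of words over the two-element field (the type bit) is the free associative
  algebra on these symbols.
\<close>

datatype sq_word = Word (letters: "nat list")

instantiation sq_word :: monoid_add
begin

definition zero_sq_word :: sq_word where "0 = Word []"

definition plus_sq_word :: "sq_word \<Rightarrow> sq_word \<Rightarrow> sq_word"
  where "a + b = Word (letters a @ letters b)"

instance
  by standard (auto simp: zero_sq_word_def plus_sq_word_def)

end

type_synonym free_sq = "sq_word \<Rightarrow>\<^sub>0 bit"

definition free_Sq :: "nat \<Rightarrow> free_sq"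
  where "free_Sq k = Poly_Mapping.single (Word [k]) 1"

text \<open>
  The relation Sq^0 = 1 and the Adem relations. The subtractions on natural numbers do not
  truncate: c \<le> a div 2 and a < 2b give c < b and 2c \<le> a.
\<close>

definition steenrod_relators :: "free_sq set"
  where "steenrod_relators = insert (free_Sq 0 - 1)
    {free_Sq a * free_Sq b
       - (\<Sum>c\<le>a div 2. of_nat ((b - c - 1) choose (a - 2 * c)) * (free_Sq (a + b - c) * free_Sq c))
     | a b. 0 < a \<and> a < 2 * b}"

inductive_set steenrod_ideal :: "free_sq set" where
  zero: "0 \<in> steenrod_ideal"
| relator: "r \<in> steenrod_relators \<Longrightarrow> p * r * q \<in> steenrod_ideal"
| add: "x \<in> steenrod_ideal \<Longrightarrow> y \<in> steenrod_ideal \<Longrightarrow> x + y \<in> steenrod_ideal"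

lemma steenrod_ideal_mult_left: "x \<in> steenrod_ideal \<Longrightarrow> p * x \<in> steenrod_ideal"
proof (induction rule: steenrod_ideal.induct)
  case (relator r p' q)
  then show ?case
    using steenrod_ideal.relator[of r "p * p'" q] by (simp add: mult.assoc)
qed (auto simp: distrib_left intro: steenrod_ideal.intros)

lemma steenrod_ideal_mult_right: "x \<in> steenrod_ideal \<Longrightarrow> x * p \<in> steenrod_ideal"
proof (induction rule: steenrod_ideal.induct)
  case (relator r p' q)
  then show ?case
    using steenrod_ideal.relator[of r p' "q * p"] by (simp add: mult.assoc)
qed (auto simp: distrib_right intro: steenrod_ideal.intros)

lemma steenrod_ideal_uminus: "x \<in> steenrod_ideal \<Longrightarrow> - x \<in> steenrod_ideal"
  using steenrod_ideal_mult_left[of x "- 1"] by simp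

quotient_type steenrod = free_sq / "\<lambda>x y. x - y \<in> steenrod_ideal"
proof (rule equivpI)
  show "reflp (\<lambda>x y. x - y \<in> steenrod_ideal)"
    by (auto intro!: reflpI steenrod_ideal.zero)
  show "symp (\<lambda>x y. x - y \<in> steenrod_ideal)"
  proof (rule sympI)
    fix x y :: free_sq
    assume "x - y \<in> steenrod_ideal"
    from steenrod_ideal_uminus[OF this] show "y - x \<in> steenrod_ideal" by simp
  qed
  show "transp (\<lambda>x y. x - y \<in> steenrod_ideal)"
  proof (rule transpI)
    fix x y z :: free_sq
    assume "x - y \<in> steenrod_ideal" "y - z \<in> steenrod_ideal"
    from steenrod_ideal.add[OF this] show "x - z \<in> steenrod_ideal" by simp
  qed
qed

instantiation steenrod :: "{ring, monoid_mult}"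
begin

lift_definition zero_steenrod :: steenrod is 0 .

lift_definition one_steenrod :: steenrod is 1 .

lift_definition plus_steenrod :: "steenrod \<Rightarrow> steenrod \<Rightarrow> steenrod" is "(+)"
  by (auto simp: add_diff_add intro: steenrod_ideal.add)

lift_definition uminus_steenrod :: "steenrod \<Rightarrow> steenrod" is uminus
proof -
  fix x y :: free_sq
  assume "x - y \<in> steenrod_ideal"
  from steenrod_ideal_uminus[OF this] show "- x - - y \<in> steenrod_ideal" by simp
qed

lift_definition minus_steenrod :: "steenrod \<Rightarrow> steenrod \<Rightarrow> steenrod" is minus
proof -
  fix x y x' y' :: free_sq
  assume "x - y \<in> steenrod_ideal" "x' - y' \<in> steenrod_ideal"
  from steenrod_ideal.add[OF this(1) steenrod_ideal_uminus[OF this(2)]]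
  show "(x - x') - (y - y') \<in> steenrod_ideal" by (simp add: algebra_simps)
qed

lift_definition times_steenrod :: "steenrod \<Rightarrow> steenrod \<Rightarrow> steenrod" is "(*)"
proof -
  fix x y x' y' :: free_sq
  assume "x - y \<in> steenrod_ideal" "x' - y' \<in> steenrod_ideal"
  from steenrod_ideal.add[OF steenrod_ideal_mult_right[OF this(1), of x']
      steenrod_ideal_mult_left[OF this(2), of y]]
  show "x * x' - y * y' \<in> steenrod_ideal" by (simp add: algebra_simps)
qed

instance
  by standard (transfer; simp add: algebra_simps steenrod_ideal.zero)+

end

lift_definition Sq :: "nat \<Rightarrow> steenrod" is free_Sq .

text \<open>Closure under scalars is automatic, the only scalars being 0 and 1.\<close>

inductive_set A1 :: "steenrod set" where
  zero: "0 \<in> A1"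
| one: "1 \<in> A1"
| Sq1: "Sq 1 \<in> A1"
| Sq2: "Sq 2 \<in> A1"
| add: "a \<in> A1 \<Longrightarrow> b \<in> A1 \<Longrightarrow> a + b \<in> A1"
| mult: "a \<in> A1 \<Longrightarrow> b \<in> A1 \<Longrightarrow> a * b \<in> A1"


section \<open>The cohomology of BO(2) and MO(2)\<close>

text \<open>
  The ring S = F_2[w_1, w_2] is represented by polynomials in w_2 whose coefficients are
  polynomials in w_1: the coefficient of w_1^n w_2^m in f is \<open>coeff (coeff f m) n\<close>.
\<close>

type_synonym S = "bit poly poly"

definition w1 :: S where "w1 = [:[:0, 1:]:]"

definition w2 :: S where "w2 = [:0, 1:]"

text \<open>
  The squares on S are packaged in Sq_t f = \<Sum>k. Sq^k(f) t^k, a polynomial in a new variable t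
  with coefficients in S. The Cartan formula says that Sq_t is a ring homomorphism, so Sq_t is
  determined by
    Sq_t w_1 = w_1 + w_1^2 t   and   Sq_t w_2 = w_2 + w_1 w_2 t + w_2^2 t^2 (Wu formula).
  Under w_1 = x + y, w_2 = x y these are the formulas forced by Sq_t x = x + x^2 t and
  Sq_t y = y + y^2 t. The product \<open>[:[:[:c:]:]:]\<close> below is the scalar c.
\<close>

definition Sqt_S :: "S \<Rightarrow> S poly"
  where "Sqt_S f = (\<Sum>m\<le>degree f. \<Sum>n\<le>degree (coeff f m).
    [:[:[:coeff (coeff f m) n:]:]:] * [:w1, w1\<^sup>2:] ^ n * [:w2, w1 * w2, w2\<^sup>2:] ^ m)"

text \<open>
  M = u S is free of rank one over S, and its element u f is represented by its coordinate f;
  thus u itself is represented by 1. The shift by |u| = 2 appears in \<open>homogeneous_part\<close>, and the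
  Thom identity Sq_t u = u (1 + w_1 t + w_2 t^2) in \<open>Sqt_M\<close>.
\<close>

type_synonym M = S

definition basis_v :: "nat \<Rightarrow> nat \<Rightarrow> M"
  where "basis_v n m = w1 ^ n * w2 ^ m"

definition Sqt_M :: "M \<Rightarrow> M poly"
  where "Sqt_M f = [:1, w1, w2:] * Sqt_S f"

definition Sq_M :: "nat \<Rightarrow> M \<Rightarrow> M"
  where "Sq_M k f = coeff (Sqt_M f) k"

definition scale_M :: "bit \<Rightarrow> M \<Rightarrow> M"
  where "scale_M c f = [:[:c:]:] * f"

definition homogeneous_part :: "nat \<Rightarrow> M \<Rightarrow> M"
  where "homogeneous_part d f =
    (\<Sum>(n, m) \<in> {(n, m). 2 + n + 2 * m = d}. scale_M (coeff (coeff f m) n) (basis_v n m))"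

text \<open>
  The free algebra acts by letting Sq^k act as \<open>Sq_M k\<close>. As the Adem relations hold in M, this
  action factors through the Steenrod algebra: the choice of the representative
  \<open>rep_steenrod a\<close> in \<open>act\<close> is immaterial.
\<close>

definition free_act :: "free_sq \<Rightarrow> M \<Rightarrow> M"
  where "free_act p f = (\<Sum>w \<in> Poly_Mapping.keys p.
    scale_M (Poly_Mapping.lookup p w) (foldr Sq_M (letters w) f))"

definition act :: "steenrod \<Rightarrow> M \<Rightarrow> M"
  where "act a f = free_act (rep_steenrod a) f"

definition A1_submodule :: "M set \<Rightarrow> bool"
  where "A1_submodule N \<longleftrightarrow>
    module.subspace scale_M N \<and> (\<forall>a\<in>A1. \<forall>f\<in>N. act a f \<in> N)"

definition graded_A1_submodule :: "M set \<Rightarrow> bool"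
  where "graded_A1_submodule N \<longleftrightarrow>
    A1_submodule N \<and> (\<forall>f\<in>N. \<forall>d. homogeneous_part d f \<in> N)"

text \<open>Internal direct sum decomposition of M.\<close>

definition is_graded_A1_direct_sum :: "M set \<Rightarrow> M set \<Rightarrow> bool"
  where "is_graded_A1_direct_sum N N' \<longleftrightarrow>
    graded_A1_submodule N \<and> graded_A1_submodule N' \<and>
    N \<inter> N' = {0} \<and> {f + g | f g. f \<in> N \<and> g \<in> N'} = UNIV"

definition M01 :: "M set"
  where "M01 = module.span scale_M {basis_v n m | n m. m mod 4 = 0 \<or> m mod 4 = 1}"

definition M23 :: "M set"
  where "M23 = module.span scale_M {basis_v n m | n m. m mod 4 = 2 \<or> m mod 4 = 3}"

end

theory Submission
  imports Defs
begin

text \<open>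
  From Sq_t v_{n,m} = v_{n,m} (1 + w_1 t)^n (1 + w_1 t + w_2 t^2)^(m+1) one reads off that Sq^1 v_{n,m}
  is a multiple of v_{n+1,m}, and Sq^2 v_{n,m} is a multiple of v_{n+2,m} plus (m+1) v_{n,m+1}. So m is
  raised only from an even value to the next odd one, which does not leave {0,1} or {2,3} mod 4.

  That this describes the action of A(1) needs the Adem relations in M. The splitting principle embeds M
  into a polynomial ring on two classes of degree 1, with u and w_2 both going to the product x y.
  There the relations follow by induction on monomials: if all of them hold on z, then they hold on x z
  for every x with Sq_t x = x + x^2 t.
\<close>

section \<open>Adem relations for operations satisfying the Cartan formula\<close>

text \<open>
  For n = -1 this is the parity of the generalised binomial coefficient, so that Pascal's rule
  holds in characteristic 2 whenever 0 \<le> n. Only n \<ge> -1 matters.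
\<close>

definition binom :: "int \<Rightarrow> int \<Rightarrow> nat"
  where "binom n k = (if k < 0 then 0 else if n < 0 then 1 else nat n choose nat k)"

lemma binom_neg [simp]: "k < 0 \<Longrightarrow> binom n k = 0"
  by (simp add: binom_def)

text \<open>Characteristic 2 enters when n = 0 < k: the left side is 0, while both terms on the
  right are 1 and cancel.\<close>

lemma binom_pascal:
  assumes char2: "(1 :: 'a::comm_ring_1) + 1 = 0" and "0 \<le> n \<or> k < 0"
  shows "(of_nat (binom n k) :: 'a) = of_nat (binom (n - 1) k) + of_nat (binom (n - 1) (k - 1))"
proof (cases "k < 0")
  case False
  then obtain i where k: "k = int i" by (metis nat_0_le not_less)
  from False assms obtain j where n: "n = int j" by (metis nat_0_le)
  show ?thesis
  proof (cases j; cases i)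
    fix i' assume "j = 0" "i = Suc i'"
    then have "n = 0" "nat k = Suc i'" "1 \<le> k"
      using n k by auto
    then show ?thesis using char2 by (simp add: binom_def)
  next
    fix j' i' assume "j = Suc j'" "i = Suc i'"
    then have "nat n = Suc j'" "nat (n - 1) = j'" "nat k = Suc i'" "nat (k - 1) = i'" "1 \<le> n" "1 \<le> k"
      using n k by auto
    then show ?thesis by (simp add: binom_def)
  qed (use char2 in \<open>auto simp: binom_def n k\<close>)
qed simp

lemma self_cancel_char2:
  assumes "(1 :: 'a::comm_ring_1) + 1 = 0"
  shows "x + x = (0 :: 'a)" "x + (x + y) = y"
proof -
  show "x + x = 0" for x :: 'a
    using assms by (metis distrib_left mult.right_neutral mult_zero_right)
  then show "x + (x + y) = y" by (metis add.assoc add_0)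
qed

text \<open>Indexing the operations by integers avoids boundary cases in the Cartan formula.\<close>

locale squares =
  fixes Q :: "int \<Rightarrow> 'a::comm_ring_1 \<Rightarrow> 'a"
  assumes char2: "(1::'a) + 1 = 0"
    and Q_add: "Q k (f + g) = Q k f + Q k g"
    and Q_neg: "k < 0 \<Longrightarrow> Q k f = 0"
begin

lemma Q_0 [simp]: "Q k 0 = 0"
  using Q_add[of k 0 0] by simp

text \<open>Terms with 2c > a vanish, so any N with a < 2N gives the full sum. A free N lets the
  sums for neighbouring pairs (a, b) share one range.\<close>

definition adem_rhs :: "nat \<Rightarrow> 'a \<Rightarrow> int \<Rightarrow> int \<Rightarrow> 'a"
  where "adem_rhs N z a b =
    (\<Sum>c\<le>N. of_nat (binom (b - int c - 1) (a - 2 * int c)) * Q (a + b - int c) (Q (int c) z))"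

definition adem :: "'a \<Rightarrow> bool"
  where "adem z \<longleftrightarrow> (\<forall>N a b. a < 2 * b \<longrightarrow> a < 2 * int N \<longrightarrow> Q a (Q b z) = adem_rhs N z a b)"

lemma adem_0: "adem 0"
  by (simp add: adem_def adem_rhs_def)

lemma adem_add: "adem y \<Longrightarrow> adem z \<Longrightarrow> adem (y + z)"
  by (simp add: adem_def adem_rhs_def Q_add distrib_left sum.distrib)

lemma adem_one:
  assumes "\<And>k. Q k 1 = of_bool (k = 0)"
  shows "adem 1"
  unfolding adem_def
proof (intro allI impI)
  fix N :: nat and a b :: int
  assume ab: "a < 2 * b" "a < 2 * int N"
  have "Q a (Q b 1) = 0"
    using ab Q_neg[of a] assms[of b] by (cases "b > 0") auto
  moreover have "of_nat (binom (b - int c - 1) (a - 2 * int c)) * Q (a + b - int c) (Q (int c) 1) = 0"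
    for c
  \<comment> \<open>Terms with c > 0 vanish because \<open>Q c 1\<close> does. For c = 0 and a \<ge>
    0, a < 2b gives a + b > 0; for a < 0 the binomial coefficient is zero.\<close>
  proof (cases "c = 0 \<and> a \<ge> 0")
    case True
    then show ?thesis using ab assms by simp
  next
    case False
    then show ?thesis using assms[of "int c"] by (cases "c = 0") auto
  qed
  ultimately show "Q a (Q b 1) = adem_rhs N 1 a b"
    by (simp add: adem_rhs_def)
qed

text \<open>In these two cases the relation reduces to a single summand.\<close>

lemma adem_rhs_trivial:
  assumes "a = 2 * b \<or> a = 2 * b + 1" "a < 2 * int N"
  shows "Q a (Q b z) = adem_rhs N z a b"
proof (cases "b < 0")
  case True
  then have "a < 0" using assms by auto
  then have "binom (b - int c - 1) (a - 2 * int c) = 0" for c by simp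
  then show ?thesis using True by (simp add: adem_rhs_def Q_neg)
next
  case False
  then obtain j where b: "b = int j" by (metis nat_0_le not_less)
  \<comment> \<open>For c < j the lower entry exceeds the upper one, for c > j it is negative, and
    for c = j the upper entry is -1, where \<open>binom\<close> is 1 by convention.\<close>
  have "binom (b - int c - 1) (a - 2 * int c) = of_bool (c = j)" for c
    using assms(1) by (auto simp: b binom_def nat_less_iff)
  then have "adem_rhs N z a b = (\<Sum>c\<le>N. if c = j then Q (a + b - int c) (Q (int c) z) else 0)"
    unfolding adem_rhs_def by (intro sum.cong) auto
  also have "\<dots> = Q a (Q b z)"
    using assms b by auto
  finally show ?thesis by simp
qed

text \<open>Multiplication by x also calls for the relation at (a, b - 1), where a < 2b yields only
  a < 2(b - 1) + 2. The two extra values of a are the trivial cases.\<close>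

lemma adem_extended:
  assumes "adem z" "a < 2 * b + 2" "a < 2 * int N"
  shows "Q a (Q b z) = adem_rhs N z a b"
proof (cases "a < 2 * b")
  case False
  with assms show ?thesis by (intro adem_rhs_trivial) auto
qed (use assms in \<open>simp add: adem_def\<close>)

lemma sum_shift:
  assumes "g 0 = (0::'a)" "h N = 0" "\<And>c. g (Suc c) = h c"
  shows "sum g {..N} = sum h {..N}"
proof (cases N)
  case (Suc n)
  then show ?thesis
    using assms sum.atMost_Suc_shift[of g n] by simp
qed (use assms in simp)

text \<open>
  By the Cartan formula the relation for x z splits into the coefficients of x, x^2 and x^4; those
  of x and x^4 are relations for z, and that of x^2 is a sum of two of them by Pascal's rule.
\<close>

lemma adem_mult:
  assumes x: "\<And>k f. Q k (x * f) = x * Q k f + x\<^sup>2 * Q (k - 1) f" and z: "adem z"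
  shows "adem (x * z)"
  unfolding adem_def
proof (intro allI impI)
  fix N :: nat and a b :: int
  assume ab: "a < 2 * b" "a < 2 * int N"
  note [simp] = self_cancel_char2[OF char2]
  \<comment> \<open>The formula for x is applied twice; the two mixed terms in x^3 cancel.\<close>
  have x2: "Q k (x\<^sup>2 * f) = x\<^sup>2 * Q k f + x ^ 4 * Q (k - 2) f" for k f
  proof -
    have "Q k (x\<^sup>2 * f) = Q k (x * (x * f))" by (simp add: power2_eq_square mult.assoc)
    also have "\<dots> = x\<^sup>2 * Q k f + x ^ 4 * Q (k - 2) f + (x ^ 3 * Q (k - 1) f + x ^ 3 * Q (k - 1) f)"
      by (simp only: x distrib_left) (simp add: algebra_simps power_numeral_reduce)
    finally show ?thesis by simp
  qed
  have QQ: "Q k (Q l (x * z)) = x * Q k (Q l z)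
      + x\<^sup>2 * (Q (k - 1) (Q l z) + Q k (Q (l - 1) z)) + x ^ 4 * Q (k - 2) (Q (l - 1) z)" for k l
    by (simp add: x x2 Q_add algebra_simps)
  define \<beta> where "\<beta> n k = (of_nat (binom n k) :: 'a)" for n k
  have pascal: "\<beta> n k = \<beta> (n - 1) k + \<beta> (n - 1) (k - 1)" if "0 \<le> n \<or> k < 0" for n k
    unfolding \<beta>_def by (rule binom_pascal[OF char2 that])
  have \<beta>_neg: "\<beta> n k = 0" if "k < 0" for n k
    using that by (simp add: \<beta>_def)
  have rhs: "adem_rhs N y k l =
      (\<Sum>c\<le>N. \<beta> (l - int c - 1) (k - 2 * int c) * Q (k + l - int c) (Q (int c) y))" for y k l
    by (simp add: adem_rhs_def \<beta>_def)
  \<comment> \<open>Shift c by one. The lost term at c = 0 contains \<open>Q (-1)\<close>, and the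
    added one at c = N has a negative lower entry since a < 2N.\<close>
  have r4: "(\<Sum>c\<le>N. \<beta> (b - int c - 1) (a - 2 * int c) * Q (a + b - int c - 2) (Q (int c - 1) z))
      = adem_rhs N z (a - 2) (b - 1)"
    unfolding rhs by (rule sum_shift) (use ab in \<open>auto simp: Q_neg \<beta>_neg algebra_simps\<close>)
  have "(\<Sum>c\<le>N. \<beta> (b - int c - 1) (a - 2 * int c) * Q (a + b - int c) (Q (int c - 1) z))
      = (\<Sum>c\<le>N. \<beta> (b - int c - 2) (a - 2 * int c - 2) * Q (a + b - int c - 1) (Q (int c) z))"
    by (rule sum_shift) (use ab in \<open>auto simp: Q_neg \<beta>_neg algebra_simps\<close>)
  then have "(\<Sum>c\<le>N. \<beta> (b - int c - 1) (a - 2 * int c) *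
        (Q (a + b - int c - 1) (Q (int c) z) + Q (a + b - int c) (Q (int c - 1) z)))
      = (\<Sum>c\<le>N. (\<beta> (b - int c - 1) (a - 2 * int c) + \<beta> (b - int c - 2) (a - 2 * int c - 2))
          * Q (a + b - int c - 1) (Q (int c) z))"
    by (simp add: distrib_left distrib_right sum.distrib)
  also have "\<dots> = (\<Sum>c\<le>N. (\<beta> (b - int c - 1) (a - 1 - 2 * int c) + \<beta> (b - 1 - int c - 1) (a - 2 * int c))
          * Q (a + b - int c - 1) (Q (int c) z))"
  proof (intro sum.cong refl arg_cong2[where f = "(*)"])
    fix c
    \<comment> \<open>Put n = b - c - 1 and k = a - 2c. Pascal's rule for (n, k) and (n, k - 1)
      turns both sides into the sum of \<open>\<beta> (n - 1)\<close> at k, k - 1 and k - 2. Its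
      side condition holds because c \<ge> b and a < 2b force k < 0.\<close>
    have "0 \<le> b - int c - 1 \<or> a - 2 * int c < 0" "0 \<le> b - int c - 1 \<or> a - 2 * int c - 1 < 0"
      using ab by auto
    note p = this[THEN pascal]
    show "\<beta> (b - int c - 1) (a - 2 * int c) + \<beta> (b - int c - 2) (a - 2 * int c - 2)
        = \<beta> (b - int c - 1) (a - 1 - 2 * int c) + \<beta> (b - 1 - int c - 1) (a - 2 * int c)"
      using p by (simp add: algebra_simps)
  qed
  also have "\<dots> = adem_rhs N z (a - 1) b + adem_rhs N z a (b - 1)"
    unfolding rhs by (simp add: distrib_right sum.distrib algebra_simps)
  finally have r2: "(\<Sum>c\<le>N. \<beta> (b - int c - 1) (a - 2 * int c) *
        (Q (a + b - int c - 1) (Q (int c) z) + Q (a + b - int c) (Q (int c - 1) z)))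
      = adem_rhs N z (a - 1) b + adem_rhs N z a (b - 1)" .
  have "adem_rhs N (x * z) a b = (\<Sum>c\<le>N. x * (\<beta> (b - int c - 1) (a - 2 * int c) * Q (a + b - int c) (Q (int c) z))
      + x\<^sup>2 * (\<beta> (b - int c - 1) (a - 2 * int c) *
        (Q (a + b - int c - 1) (Q (int c) z) + Q (a + b - int c) (Q (int c - 1) z)))
      + x ^ 4 * (\<beta> (b - int c - 1) (a - 2 * int c) * Q (a + b - int c - 2) (Q (int c - 1) z)))"
    unfolding rhs by (intro sum.cong refl, subst QQ) (simp only: distrib_left mult_ac)
  also have "\<dots> = x * adem_rhs N z a b
      + x\<^sup>2 * (adem_rhs N z (a - 1) b + adem_rhs N z a (b - 1)) + x ^ 4 * adem_rhs N z (a - 2) (b - 1)"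
    by (simp only: sum.distrib sum_distrib_left[symmetric] r2 r4 rhs[of z a b])
  also have "\<dots> = Q a (Q b (x * z))"
  proof -
    have "Q a (Q b z) = adem_rhs N z a b" "Q (a - 1) (Q b z) = adem_rhs N z (a - 1) b"
      "Q a (Q (b - 1) z) = adem_rhs N z a (b - 1)"
      "Q (a - 2) (Q (b - 1) z) = adem_rhs N z (a - 2) (b - 1)"
      by (rule adem_extended[OF z]; use ab in simp)+
    then show ?thesis by (simp only: QQ)
  qed
  finally show "Q a (Q b (x * z)) = adem_rhs N (x * z) a b" by simp
qed

text \<open>Return to natural indices, as in the relators: N = a is admissible since a > 0, terms
  beyond \<open>a div 2\<close> vanish, and in the remaining range \<open>binom\<close> is the
  ordinary coefficient.\<close>

lemma adem_relation:
  assumes "adem z" "0 < a" "a < 2 * b"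
  shows "Q (int a) (Q (int b) z) =
    (\<Sum>c\<le>a div 2. of_nat ((b - c - 1) choose (a - 2 * c)) * Q (int (a + b - c)) (Q (int c) z))"
proof -
  have "Q (int a) (Q (int b) z) = adem_rhs a z (int a) (int b)"
    using assms by (simp add: adem_def)
  also have "\<dots> = (\<Sum>c\<le>a div 2. of_nat (binom (int b - int c - 1) (int a - 2 * int c))
      * Q (int a + int b - int c) (Q (int c) z))"
    unfolding adem_rhs_def
  proof (rule sum.mono_neutral_right)
    show "\<forall>c\<in>{..a} - {..a div 2}. of_nat (binom (int b - int c - 1) (int a - 2 * int c))
        * Q (int a + int b - int c) (Q (int c) z) = 0"
    proof
      fix c assume "c \<in> {..a} - {..a div 2}"
      then have "int a - 2 * int c < 0" by auto
      then show "of_nat (binom (int b - int c - 1) (int a - 2 * int c))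
          * Q (int a + int b - int c) (Q (int c) z) = 0" by simp
    qed
  qed auto
  also have "\<dots> = (\<Sum>c\<le>a div 2. of_nat ((b - c - 1) choose (a - 2 * c)) * Q (int (a + b - c)) (Q (int c) z))"
  proof (intro sum.cong refl)
    fix c assume "c \<in> {..a div 2}"
    then have c: "2 * c \<le> a" "c < b" using assms by auto
    then have "nat (int b - int c - 1) = b - c - 1" "nat (int a - 2 * int c) = a - 2 * c"
      "0 \<le> int a - 2 * int c" "0 \<le> int b - int c - 1" "int a + int b - int c = int (a + b - c)"
      by linarith+
    then show "of_nat (binom (int b - int c - 1) (int a - 2 * int c))
        * Q (int a + int b - int c) (Q (int c) z)
      = of_nat ((b - c - 1) choose (a - 2 * c)) * Q (int (a + b - c)) (Q (int c) z)"
      by (simp only: binom_def not_less[symmetric] if_False simp_thms)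
  qed
  finally show ?thesis .
qed

end

section \<open>The total squares as evaluation homomorphisms\<close>

lemma S_char2: "(1 :: S) + 1 = 0"
  by (intro poly_eqI) (simp add: coeff_pCons one_pCons split: nat.splits)

lemma S_pCons_eq: "pCons a p = [:a:] + w2 * (p :: S)" "[:pCons c q:] = [:[:c:]:] + w1 * [:q:]"
  by (simp_all add: w1_def w2_def)

text \<open>The only nonzero scalar is 1, so sums and multiplication by the generators reach all of
  S from 0 and 1. Additive identities thus reduce to their Cartan formulas.\<close>

lemma S_induct [case_names zero one add w1 w2]:
  assumes "P 0" "P 1" and add: "\<And>f g. P f \<Longrightarrow> P g \<Longrightarrow> P (f + g)"
    and w1: "\<And>f. P f \<Longrightarrow> P (w1 * f)" and w2: "\<And>f. P f \<Longrightarrow> P (w2 * f)"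
  shows "P (f :: S)"
proof (induction f)
  case (pCons a p)
  have "P [:q:]" for q
  proof (induction q)
    case (pCons c q)
    have "P [:[:c:]:]"
      using assms(1,2) by (cases c) (simp_all add: one_pCons)
    with pCons show ?case by (subst S_pCons_eq(2)) (intro add w1)
  qed (use assms(1) in simp)
  with pCons show ?case by (subst S_pCons_eq(1)) (intro add w2)
qed (fact assms(1))

definition eval1 :: "S poly \<Rightarrow> bit poly \<Rightarrow> S poly"
  where "eval1 \<alpha> q = poly (map_poly (\<lambda>c. [:[:[:c:]:]:]) q) \<alpha>"

text \<open>Substitution of \<alpha> for w_1 and \<beta> for w_2, with values in S[t]. Two choices
  of \<beta> give the total square on S and on the splitting ring.\<close>

definition eval2 :: "S poly \<Rightarrow> S poly \<Rightarrow> S \<Rightarrow> S poly"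
  where "eval2 \<alpha> \<beta> f = poly (map_poly (eval1 \<alpha>) f) \<beta>"

lemma eval1_0 [simp]: "eval1 \<alpha> 0 = 0"
  by (simp add: eval1_def)

lemma eval1_pCons: "eval1 \<alpha> (pCons c q) = [:[:[:c:]:]:] + \<alpha> * eval1 \<alpha> q"
  by (simp add: eval1_def map_poly_pCons)

lemma eval1_add: "eval1 \<alpha> (p + q) = eval1 \<alpha> p + eval1 \<alpha> q"
  by (induction p q rule: poly_induct2) (simp_all add: eval1_pCons algebra_simps)

lemma eval2_0 [simp]: "eval2 \<alpha> \<beta> 0 = 0"
  by (simp add: eval2_def)

lemma eval2_pCons: "eval2 \<alpha> \<beta> (pCons a p) = eval1 \<alpha> a + \<beta> * eval2 \<alpha> \<beta> p"
  by (simp add: eval2_def map_poly_pCons)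

lemma eval2_add: "eval2 \<alpha> \<beta> (p + q) = eval2 \<alpha> \<beta> p + eval2 \<alpha> \<beta> q"
  by (induction p q rule: poly_induct2) (simp_all add: eval2_pCons eval1_add algebra_simps)

lemma eval2_1 [simp]: "eval2 \<alpha> \<beta> 1 = 1"
  by (simp add: one_pCons eval2_pCons eval1_pCons)

lemma eval2_w1: "eval2 \<alpha> \<beta> (w1 * f) = \<alpha> * eval2 \<alpha> \<beta> f"
proof (induction f)
  case (pCons a p)
  have "w1 * pCons a p = pCons (pCons 0 a) (w1 * p)"
    by (simp add: w1_def)
  then show ?case
    using pCons by (simp add: eval2_pCons eval1_pCons algebra_simps)
qed simp

lemma eval2_w2: "eval2 \<alpha> \<beta> (w2 * f) = \<beta> * eval2 \<alpha> \<beta> f"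
  by (simp add: w2_def eval2_pCons)

lemma poly_map_poly_altdef:
  fixes h :: "'a::zero \<Rightarrow> 'b::comm_semiring_1"
  assumes "h 0 = 0"
  shows "poly (map_poly h p) x = (\<Sum>i\<le>degree p. h (coeff p i) * x ^ i)"
proof -
  have deg: "degree (map_poly h p) \<le> degree p"
    by (rule degree_le) (simp add: coeff_map_poly assms coeff_eq_0)
  have "poly (map_poly h p) x = (\<Sum>i\<le>degree p. coeff (map_poly h p) i * x ^ i)"
    unfolding poly_altdef
    by (rule sum.mono_neutral_left) (use deg in \<open>auto simp: coeff_eq_0\<close>)
  then show ?thesis by (simp add: coeff_map_poly assms)
qed

lemma Sqt_S_eq_eval2: "Sqt_S f = eval2 [:w1, w1\<^sup>2:] [:w2, w1 * w2, w2\<^sup>2:] f"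
proof -
  have eval1: "eval1 \<alpha> q = (\<Sum>n\<le>degree q. [:[:[:coeff q n:]:]:] * \<alpha> ^ n)" for \<alpha> q
    unfolding eval1_def by (rule poly_map_poly_altdef) simp
  have "eval2 \<alpha> \<beta> f = (\<Sum>m\<le>degree f. eval1 \<alpha> (coeff f m) * \<beta> ^ m)" for \<alpha> \<beta>
    unfolding eval2_def by (rule poly_map_poly_altdef) simp
  then show ?thesis
    unfolding Sqt_S_def eval1 sum_distrib_right by simp
qed

section \<open>Cartan formulas for the individual squares\<close>

definition icoeff :: "'a::zero poly \<Rightarrow> int \<Rightarrow> 'a"
  where "icoeff p k = (if k < 0 then 0 else coeff p (nat k))"

lemma icoeff_add: "icoeff (p + q) k = icoeff p k + icoeff q k"
  by (simp add: icoeff_def)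

lemma icoeff_mult3:
  fixes a b c :: "'a::comm_ring_1"
  shows "icoeff ([:a, b, c:] * p) k = a * icoeff p k + b * icoeff p (k - 1) + c * icoeff p (k - 2)"
proof -
  consider "k < 0" | "k = 0" | "k = 1" | j where "k = int (Suc (Suc j))"
  proof -
    have "k < 0 \<or> k = 0 \<or> k = 1 \<or> k = int (Suc (Suc (nat (k - 2))))" by linarith
    with that show thesis by blast
  qed
  then show ?thesis
    by cases (simp_all add: icoeff_def nat_add_distrib)
qed

lemma icoeff_mult2:
  fixes a b :: "'a::comm_ring_1"
  shows "icoeff ([:a, b:] * p) k = a * icoeff p k + b * icoeff p (k - 1)"
  using icoeff_mult3[of a b 0 p k] by simp

text \<open>
  \<open>QM k\<close> is Sq^k on M. For \<open>QT\<close>, the outer variable of the same polynomial type is read as a class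
  x of degree 1 instead of w_2: the type then represents the ring F_2[x, y] with w_1 = x + y.
\<close>

definition QM :: "int \<Rightarrow> M \<Rightarrow> M"
  where "QM k f = icoeff (Sqt_M f) k"

definition QT :: "int \<Rightarrow> S \<Rightarrow> S"
  where "QT k f = icoeff (eval2 [:w1, w1\<^sup>2:] [:w2, w2\<^sup>2:] f) k"

lemma Sq_M_eq_QM: "Sq_M k = QM (int k)"
  by (simp add: fun_eq_iff Sq_M_def QM_def icoeff_def)

lemma Sqt_M_1: "Sqt_M 1 = [:1, w1, w2:]"
  by (simp add: Sqt_M_def Sqt_S_eq_eval2)

lemma Sqt_M_add: "Sqt_M (f + g) = Sqt_M f + Sqt_M g"
  by (simp only: Sqt_M_def Sqt_S_eq_eval2 eval2_add distrib_left)

lemma Sqt_M_w1: "Sqt_M (w1 * f) = [:w1, w1\<^sup>2:] * Sqt_M f"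
  by (simp only: Sqt_M_def Sqt_S_eq_eval2 eval2_w1 mult.left_commute)

lemma Sqt_M_w2: "Sqt_M (w2 * f) = [:w2, w1 * w2, w2\<^sup>2:] * Sqt_M f"
  by (simp only: Sqt_M_def Sqt_S_eq_eval2 eval2_w2 mult.left_commute)

lemma QM_add: "QM k (f + g) = QM k f + QM k g"
  by (simp add: QM_def Sqt_M_add icoeff_add)

lemma QM_0 [simp]: "QM k 0 = 0"
  by (simp add: QM_def Sqt_M_def Sqt_S_eq_eval2 icoeff_def)

lemma QM_neg: "k < 0 \<Longrightarrow> QM k f = 0"
  by (simp add: QM_def icoeff_def)

lemma QM_w1: "QM k (w1 * f) = w1 * QM k f + w1\<^sup>2 * QM (k - 1) f"
  unfolding QM_def Sqt_M_w1 by (rule icoeff_mult2)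

lemma QM_w2: "QM k (w2 * f) = w2 * QM k f + w1 * w2 * QM (k - 1) f + w2\<^sup>2 * QM (k - 2) f"
  unfolding QM_def Sqt_M_w2 by (rule icoeff_mult3)

lemma QT_w1: "QT k (w1 * f) = w1 * QT k f + w1\<^sup>2 * QT (k - 1) f"
  unfolding QT_def eval2_w1 by (rule icoeff_mult2)

lemma QT_w2: "QT k (w2 * f) = w2 * QT k f + w2\<^sup>2 * QT (k - 1) f"
  unfolding QT_def eval2_w2 by (rule icoeff_mult2)

lemma QT_1: "QT k 1 = of_bool (k = 0)"
  by (auto simp: QT_def icoeff_def coeff_1 of_bool_def)

interpretation T: squares QT
  by standard (use S_char2 in \<open>auto simp: QT_def eval2_add icoeff_add icoeff_def\<close>)

lemma adem_T: "T.adem f"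
  by (induction f rule: S_induct)
     (auto intro: T.adem_0 T.adem_one QT_1 T.adem_add T.adem_mult QT_w1 QT_w2)


section \<open>The Adem relations in the cohomology of the Thom space\<close>

text \<open>
  Here w_2 goes to x y = x (w_1 + x), and so does u, because the Thom identity and the Wu formula
  for w_2 agree.
\<close>

definition xy :: S
  where "xy = w2\<^sup>2 + w1 * w2"

definition split_M :: "M \<Rightarrow> S"
  where "split_M f = xy * pcompose f xy"

lemma split_M_0 [simp]: "split_M 0 = 0"
  by (simp add: split_M_def)

lemma split_M_add: "split_M (f + g) = split_M f + split_M g"
  by (simp add: split_M_def pcompose_add distrib_left)

lemma split_M_w1: "split_M (w1 * f) = w1 * split_M f"
proof -
  have "pcompose w1 xy = w1" by (simp add: w1_def)
  then show ?thesis by (simp add: split_M_def pcompose_mult)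
qed

lemma split_M_w2: "split_M (w2 * f) = xy * split_M f"
proof -
  have "pcompose w2 xy = xy" by (simp add: w2_def pcompose_pCons)
  then show ?thesis by (simp add: split_M_def pcompose_mult)
qed

lemma split_M_of_nat: "split_M (of_nat n * f) = of_nat n * split_M f"
  by (induction n) (simp_all add: distrib_right split_M_add)

lemma split_M_sum: "split_M (sum g A) = (\<Sum>i\<in>A. split_M (g i))"
  by (induction A rule: infinite_finite_induct) (simp_all add: split_M_add)

text \<open>Coefficients lie in a domain and \<open>xy\<close> has positive degree in the outer
  variable, so neither the substitution nor the factor \<open>xy\<close> kills anything
  nonzero.\<close>

lemma split_M_eq_0_iff: "split_M f = 0 \<longleftrightarrow> f = 0"
proof -
  have xy: "xy = [:0, [:0, 1:], 1:]"
    by (simp add: xy_def w1_def w2_def power2_eq_square)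
  have "degree xy > 0" by (simp add: xy)
  moreover from this have "xy \<noteq> 0" by auto
  ultimately show ?thesis
    by (simp add: split_M_def pcompose_eq_0_iff)
qed

lemma split_M_inject: "split_M f = split_M g \<Longrightarrow> f = g"
  using split_M_add[of "f - g" g] split_M_eq_0_iff[of "f - g"] by simp

text \<open>The Wu formula for w_2, recovered from degree-one classes by expanding x^2 + w_1 x;
  terms occurring twice cancel.\<close>

lemma QT_xy: "QT k (xy * f) = xy * QT k f + w1 * xy * QT (k - 1) f + xy\<^sup>2 * QT (k - 2) f"
proof -
  note [simp] = self_cancel_char2[OF S_char2]
  have "QT k (xy * f) = QT k (w2 * (w2 * f)) + QT k (w1 * (w2 * f))"
    by (simp add: xy_def T.Q_add[symmetric] algebra_simps power2_eq_square)
  also have "\<dots> = xy * QT k f + w1 * xy * QT (k - 1) f + (w2 ^ 4 + w1\<^sup>2 * w2\<^sup>2) * QT (k - 2) f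
      + (w2 ^ 3 * QT (k - 1) f + w2 ^ 3 * QT (k - 1) f)"
    by (simp only: QT_w1 QT_w2 distrib_left)
       (simp add: xy_def algebra_simps power_numeral_reduce)
  also have "w2 ^ 4 + w1\<^sup>2 * w2\<^sup>2 = xy\<^sup>2 + (w1 * w2 ^ 3 + w1 * w2 ^ 3)"
    by (simp only: xy_def) (simp add: algebra_simps power_numeral_reduce)
  finally show ?thesis by simp
qed

text \<open>On u, the Thom identity becomes \<open>QT_xy\<close> applied to 1. Multiplication by w_1
  and w_2 then obeys the same Cartan formulas on both sides.\<close>

lemma split_M_QM: "split_M (QM k f) = QT k (split_M f)"
proof (induction f arbitrary: k rule: S_induct)
  case zero
  show ?case by simp
next
  case one
  have "split_M (QM k 1) = xy * QT k 1 + w1 * xy * QT (k - 1) 1 + xy\<^sup>2 * QT (k - 2) 1"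
  proof -
    have "QM k 1 = 1 * icoeff 1 k + w1 * icoeff 1 (k - 1) + w2 * icoeff 1 (k - 2)"
      using icoeff_mult3[of 1 w1 w2 1 k] by (simp add: QM_def Sqt_M_1)
    moreover have "icoeff 1 j = QT j 1" for j
      by (simp add: QT_def)
    moreover have "split_M 1 = xy" by (simp add: split_M_def pcompose_1)
    ultimately show ?thesis
      using split_M_w1[of 1] split_M_w2[of 1]
      by (auto simp: QT_1 split_M_add power2_eq_square)
  qed
  then show ?case by (simp add: QT_xy[symmetric] split_M_def pcompose_1)
next
  case (w1 f)
  then show ?case
    by (simp add: QM_w1 QT_w1 split_M_add split_M_w1 power2_eq_square mult.assoc)
next
  case (w2 f)
  then show ?case
    by (simp add: QM_w2 QT_xy split_M_add split_M_w1 split_M_w2 power2_eq_square mult.assoc)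
qed (simp add: QM_add T.Q_add split_M_add)

text \<open>The relation holds in the splitting ring and is pulled back along the injective
  \<open>split_M\<close>, which commutes with the squares.\<close>

lemma adem_M:
  assumes "0 < a" "a < 2 * b"
  shows "Sq_M a (Sq_M b f) =
    (\<Sum>c\<le>a div 2. of_nat ((b - c - 1) choose (a - 2 * c)) * Sq_M (a + b - c) (Sq_M c f))"
  by (rule split_M_inject)
     (use T.adem_relation[OF adem_T assms] in
       \<open>simp add: Sq_M_eq_QM split_M_sum split_M_of_nat split_M_QM\<close>)

lemma Sq_M_0: "Sq_M 0 f = f"
proof (induction f rule: S_induct)
  case zero
  show ?case by (simp add: Sq_M_eq_QM)
next
  case one
  then show ?case by (simp add: Sq_M_def Sqt_M_1)
qed (simp_all add: Sq_M_eq_QM QM_add QM_w1 QM_w2 QM_neg)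

lemma Sq_M_add: "Sq_M k (f + g) = Sq_M k f + Sq_M k g"
  by (simp add: Sq_M_eq_QM QM_add)

lemma Sq_M_zero [simp]: "Sq_M k 0 = 0"
  by (simp add: Sq_M_eq_QM)


section \<open>The action of the Steenrod algebra\<close>

lemma scale_M_bit [simp]: "scale_M 0 f = 0" "scale_M 1 f = f"
  by (simp_all add: scale_M_def pCons_one)

interpretation M: module scale_M
proof
  show "scale_M (a + b) f = scale_M a f + scale_M b f" for a b f
    by (cases a; cases b) (simp_all add: self_cancel_char2[OF S_char2])
  show "scale_M a (scale_M b f) = scale_M (a * b) f" for a b f
    by (cases a; cases b) simp_all
  show "scale_M a (f + g) = scale_M a f + scale_M a g" for a f g
    by (simp only: scale_M_def distrib_left)
qed simp

text \<open>A new key enters with a nonzero coefficient in \<open>bit\<close>, hence with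
  coefficient 1.\<close>

lemma free_sq_induct [case_names zero add]:
  assumes "P 0" and "\<And>w p. P p \<Longrightarrow> P (Poly_Mapping.single w 1 + p)"
  shows "P (p :: free_sq)"
proof (induction p rule: Poly_Mapping.update_induct)
  case (update p w c)
  have "Poly_Mapping.update w c p = Poly_Mapping.single w 1 + p"
    using update by (intro poly_mapping_eqI) (auto simp: lookup_update lookup_add lookup_single in_keys_iff)
  with update assms(2) show ?case by simp
qed (fact assms(1))

text \<open>Keys may cancel in p + q; a common finite index set makes the three sums
  comparable.\<close>

lemma free_act_superset:
  assumes "finite A" "Poly_Mapping.keys p \<subseteq> A"
  shows "free_act p f = (\<Sum>w\<in>A. scale_M (Poly_Mapping.lookup p w) (foldr Sq_M (letters w) f))"
  unfolding free_act_def by (rule sum.mono_neutral_left) (use assms in \<open>auto simp: in_keys_iff\<close>)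

lemma free_act_add: "free_act (p + q) f = free_act p f + free_act q f"
proof -
  let ?A = "Poly_Mapping.keys p \<union> Poly_Mapping.keys q"
  have "Poly_Mapping.keys (p + q) \<subseteq> ?A" by (rule keys_add)
  then show ?thesis
    by (simp only: free_act_superset[of ?A] finite_UnI finite_keys Un_upper1 Un_upper2
        lookup_add M.scale_left_distrib sum.distrib)
qed

lemma free_act_0 [simp]: "free_act 0 f = 0"
  by (simp add: free_act_def)

lemma free_act_diff: "free_act (p - q) f = free_act p f - free_act q f"
  using free_act_add[of "p - q" q f] by simp

lemma free_act_sum: "free_act (sum p A) f = (\<Sum>i\<in>A. free_act (p i) f)"
  by (induction A rule: infinite_finite_induct) (simp_all add: free_act_add)

lemma free_act_single: "free_act (Poly_Mapping.single w 1) f = foldr Sq_M (letters w) f"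
  by (simp add: free_act_def)

lemma free_act_1 [simp]: "free_act 1 f = f"
proof -
  have "letters 0 = []" by (simp add: zero_sq_word_def)
  then show ?thesis using free_act_single[of 0 f] by simp
qed

lemma free_act_of_nat: "free_act (of_nat n) f = of_nat n * f"
  by (induction n) (simp_all add: distrib_right free_act_add)

lemma free_act_free_Sq: "free_act (free_Sq k) f = Sq_M k f"
  by (simp add: free_Sq_def free_act_single)

lemma foldr_Sq_M_add: "foldr Sq_M ks (f + g) = foldr Sq_M ks f + foldr Sq_M ks g"
  by (induction ks) (simp_all add: Sq_M_add)

lemma foldr_Sq_M_zero: "foldr Sq_M ks 0 = 0"
  by (induction ks) simp_all

text \<open>Concatenated words act by composition, and both sides are additive in p and in
  q.\<close>

lemma free_act_mult: "free_act (p * q) f = free_act p (free_act q f)"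
proof (induction p rule: free_sq_induct)
  case (add w p)
  have "free_act (Poly_Mapping.single w 1 * q) f = foldr Sq_M (letters w) (free_act q f)"
  proof (induction q rule: free_sq_induct)
    case zero
    show ?case by (simp add: foldr_Sq_M_zero)
  next
    case (add v q)
    then show ?case
      by (simp add: distrib_left free_act_add foldr_Sq_M_add mult_single free_act_single plus_sq_word_def)
  qed
  with add show ?case by (simp add: distrib_right free_act_add free_act_single)
qed simp

lemma free_act_zero_right [simp]: "free_act p 0 = 0"
  using free_act_mult[of p 0 0] by simp

text \<open>This lets the action descend to \<open>steenrod\<close>: relators act as zero by
  \<open>Sq_M_0\<close> and \<open>adem_M\<close>, and so do their two-sided multiples by
  \<open>free_act_mult\<close>.\<close>

lemma free_act_steenrod_ideal:
  assumes "p \<in> steenrod_ideal"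
  shows "free_act p f = 0"
  using assms
proof (induction arbitrary: f rule: steenrod_ideal.induct)
  case (relator r p q)
  then have "free_act r g = 0" for g
    unfolding steenrod_relators_def
    by (auto simp: free_act_diff free_act_sum free_act_of_nat free_act_mult free_act_free_Sq
        Sq_M_0 adem_M)
  then show ?case by (simp add: free_act_mult)
qed (simp_all add: free_act_add)

lemma act_abs_steenrod: "act (abs_steenrod p) f = free_act p f"
proof -
  have "rep_steenrod (abs_steenrod p) - p \<in> steenrod_ideal"
    using Quotient3_rep_abs[OF Quotient3_steenrod, of p] steenrod_ideal.zero by simp
  from free_act_steenrod_ideal[OF this, of f] show ?thesis
    by (simp add: act_def free_act_diff)
qed

lemma act_simps:
  "act 0 f = 0" "act 1 f = f" "act (Sq k) f = Sq_M k f"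
  by (simp_all add: zero_steenrod_def one_steenrod_def Sq_def act_abs_steenrod free_act_free_Sq)

lemma act_add: "act (a + b) f = act a f + act b f"
proof (induction a; induction b)
  fix p q show "act (abs_steenrod p + abs_steenrod q) f = act (abs_steenrod p) f + act (abs_steenrod q) f"
    by (simp add: plus_steenrod.abs_eq act_abs_steenrod free_act_add)
qed

lemma act_mult: "act (a * b) f = act a (act b f)"
proof (induction a; induction b)
  fix p q show "act (abs_steenrod p * abs_steenrod q) f = act (abs_steenrod p) (act (abs_steenrod q) f)"
    by (simp add: times_steenrod.abs_eq act_abs_steenrod free_act_mult)
qed

text \<open>Sums and products in \<open>A1\<close> act as sums and composites, so closure under the
  two generators suffices.\<close>

lemma A1_submoduleI:
  assumes "M.subspace N" "\<And>f. f \<in> N \<Longrightarrow> Sq_M 1 f \<in> N" "\<And>f. f \<in> N \<Longrightarrow> Sq_M 2 f \<in> N"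
  shows "A1_submodule N"
proof -
  have "act a f \<in> N" if "a \<in> A1" "f \<in> N" for a f
    using that assms
    by (induction arbitrary: f rule: A1.induct)
       (auto simp: act_simps act_add act_mult M.subspace_0 M.subspace_add)
  with assms(1) show ?thesis by (simp add: A1_submodule_def)
qed


section \<open>Spans of basis vectors\<close>

lemma coeff_1_w1_w2_power:
  fixes a b :: "'a::comm_ring_1"
  shows "coeff ([:1, a, b:] ^ n) 0 = 1"
    and "coeff ([:1, a, b:] ^ n) 1 = of_nat n * a"
    and "coeff ([:1, a, b:] ^ n) 2 = of_nat (n choose 2) * a\<^sup>2 + of_nat n * b"
proof -
  show 0: "coeff ([:1, a, b:] ^ n) 0 = 1" for n
    by (induction n) (simp_all add: coeff_mult_0)
  show 1: "coeff ([:1, a, b:] ^ n) 1 = of_nat n * a" for n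
    using 0 by (induction n) (simp_all add: algebra_simps)
  show "coeff ([:1, a, b:] ^ n) 2 = of_nat (n choose 2) * a\<^sup>2 + of_nat n * b"
    using 0 1 by (induction n) (simp_all add: algebra_simps numeral_2_eq_2)
qed

text \<open>Each w_1 contributes a factor 1 + w_1 t and each w_2 a factor 1 + w_1 t + w_2 t^2. The
  Thom class contributes one more of the latter, whence \<open>Suc m\<close>.\<close>

lemma Sqt_M_basis_v:
  "Sqt_M (basis_v n m) = [:basis_v n m:] * ([:1, w1:] ^ n * [:1, w1, w2:] ^ Suc m)"
proof (induction n)
  case 0
  show ?case
  proof (induction m)
    case (Suc m)
    have "basis_v 0 (Suc m) = w2 * basis_v 0 m"
      by (simp add: basis_v_def)
    then have "Sqt_M (basis_v 0 (Suc m)) = [:w2, w1 * w2, w2\<^sup>2:] * Sqt_M (basis_v 0 m)"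
      by (simp only: Sqt_M_w2)
    also have "[:w2, w1 * w2, w2\<^sup>2:] = [:w2:] * [:1, w1, w2:]"
      by (simp add: power2_eq_square mult.commute)
    also have "\<dots> * Sqt_M (basis_v 0 m)
        = ([:w2:] * [:basis_v 0 m:]) * ([:1, w1:] ^ 0 * [:1, w1, w2:] ^ Suc (Suc m))"
      by (simp only: Suc power_Suc mult_ac)
    also have "[:w2:] * [:basis_v 0 m:] = [:basis_v 0 (Suc m):]"
      by (simp add: basis_v_def)
    finally show ?case .
  qed (simp add: basis_v_def Sqt_M_1)
next
  case (Suc n)
  have "basis_v (Suc n) m = w1 * basis_v n m"
    by (simp add: basis_v_def mult.assoc)
  then have "Sqt_M (basis_v (Suc n) m) = [:w1, w1\<^sup>2:] * Sqt_M (basis_v n m)"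
    by (simp only: Sqt_M_w1)
  also have "[:w1, w1\<^sup>2:] = [:w1:] * [:1, w1:]"
    by (simp add: power2_eq_square)
  also have "\<dots> * Sqt_M (basis_v n m)
      = ([:w1:] * [:basis_v n m:]) * ([:1, w1:] ^ Suc n * [:1, w1, w2:] ^ Suc m)"
    by (simp only: Suc power_Suc mult_ac)
  also have "[:w1:] * [:basis_v n m:] = [:basis_v (Suc n) m:]"
    by (simp add: basis_v_def mult.assoc)
  finally show ?case .
qed

lemma Sq_M_basis_v:
  "Sq_M 1 (basis_v n m) = of_nat (n + Suc m) * basis_v (Suc n) m"
  "Sq_M 2 (basis_v n m) = of_nat ((n choose 2) + n * Suc m + (Suc m choose 2)) * basis_v (n + 2) m
     + of_nat (Suc m) * basis_v n (Suc m)"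
proof -
  define A where "A = [:1, w1:] ^ n"
  define B where "B = [:1, w1, w2:] ^ Suc m"
  have A: "coeff A 0 = 1" "coeff A 1 = of_nat n * w1" "coeff A 2 = of_nat (n choose 2) * w1\<^sup>2"
    using coeff_1_w1_w2_power[of w1 0 n] by (simp_all add: A_def)
  have B: "coeff B 0 = 1" "coeff B 1 = of_nat (Suc m) * w1"
    "coeff B 2 = of_nat (Suc m choose 2) * w1\<^sup>2 + of_nat (Suc m) * w2"
    unfolding B_def by (fact coeff_1_w1_w2_power)+
  have Sq: "Sq_M k (basis_v n m) = basis_v n m * coeff (A * B) k" for k
    by (simp add: Sq_M_def Sqt_M_basis_v A_def B_def del: power_Suc)
  have "coeff (A * B) 1 = of_nat (n + Suc m) * w1"
    using A B by (simp add: coeff_mult algebra_simps)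
  then show "Sq_M 1 (basis_v n m) = of_nat (n + Suc m) * basis_v (Suc n) m"
    unfolding Sq by (simp add: basis_v_def algebra_simps)
  have "coeff (A * B) 2 = of_nat ((n choose 2) + n * Suc m + (Suc m choose 2)) * w1\<^sup>2 + of_nat (Suc m) * w2"
    using A B by (simp add: coeff_mult numeral_2_eq_2 algebra_simps)
  then show "Sq_M 2 (basis_v n m) = of_nat ((n choose 2) + n * Suc m + (Suc m choose 2)) * basis_v (n + 2) m
     + of_nat (Suc m) * basis_v n (Suc m)"
    unfolding Sq by (simp add: basis_v_def algebra_simps power2_eq_square)
qed

section \<open>Subspaces spanned by the basis vectors with prescribed exponents of w_2\<close>

definition w2_span :: "nat set \<Rightarrow> M set"
  where "w2_span I = M.span {basis_v n m | n m. m \<in> I}"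

lemma subspace_w2_span: "M.subspace (w2_span I)"
  by (simp add: w2_span_def)

lemma basis_v_in_w2_span: "m \<in> I \<Longrightarrow> basis_v n m \<in> w2_span I"
  unfolding w2_span_def by (rule M.span_base) auto

lemma subspace_of_nat_mult: "M.subspace N \<Longrightarrow> f \<in> N \<Longrightarrow> of_nat n * f \<in> N"
  by (induction n) (simp_all add: distrib_right M.subspace_0 M.subspace_add)

text \<open>Over the two-element field an additive map is linear, so its values on basis vectors
  decide.\<close>

lemma additive_w2_span:
  assumes "f \<in> w2_span I" "M.subspace N" "h 0 = 0" "\<And>f g. h (f + g) = h f + h g"
    and "\<And>n m. m \<in> I \<Longrightarrow> h (basis_v n m) \<in> N"
  shows "h f \<in> N"
  using assms(1) unfolding w2_span_def
proof (induction rule: M.span_induct_alt)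
  case base
  show ?case using assms by (simp add: M.subspace_0)
next
  case (step c x y)
  then have "h x \<in> N" "h 0 \<in> N" "h y \<in> N" using assms by (auto simp: M.subspace_0)
  then show ?case using assms by (cases c) (auto simp: M.subspace_add)
qed

lemma coeff_w2_span:
  assumes "f \<in> w2_span I" "m \<notin> I"
  shows "coeff f m = 0"
proof -
  have basis: "coeff (basis_v n k) m = 0" if "k \<in> I" for n k
  proof -
    have "k \<noteq> m" using that assms(2) by blast
    have "basis_v n k = [:[:0, 1:] ^ n:] * [:0, 1:] ^ k"
      by (simp only: basis_v_def w1_def w2_def poly_const_pow)
    also have "\<dots> = monom ([:0, 1:] ^ n) k"
      by (simp only: monom_altdef mult_pCons_left mult_zero_left pCons_0_0 add_0_right)
    finally have "coeff (basis_v n k) m = (if k = m then [:0, 1:] ^ n else 0)"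
      by (simp only: coeff_monom)
    with \<open>k \<noteq> m\<close> show ?thesis by (simp only: if_False)
  qed
  have "M.subspace {0}" by (simp add: M.subspace_def)
  \<comment> \<open>The coefficient is wrapped as a constant polynomial to obtain an additive map
    from M to M, whose values are then shown to lie in the zero subspace.\<close>
  from additive_w2_span[OF assms(1) this, of "\<lambda>g. [:coeff g m:]"] basis
  have "[:coeff f m:] \<in> {0 :: M}" by simp
  then show ?thesis by simp
qed

lemma w2_span_UNIV: "w2_span UNIV = UNIV"
proof -
  have "f \<in> w2_span UNIV" for f
  proof (induction f rule: S_induct)
    case one
    show ?case using basis_v_in_w2_span[of 0 UNIV 0] by (simp add: basis_v_def)
  next
    case (w1 f)
    have "w1 * basis_v n m \<in> w2_span UNIV" for n m
      using basis_v_in_w2_span[of m UNIV "Suc n"] by (simp add: basis_v_def mult.assoc)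
    with w1 show ?case
      by (intro additive_w2_span[of f UNIV _ "(*) w1"] subspace_w2_span) (auto simp: distrib_left)
  next
    case (w2 f)
    have "w2 * basis_v n m \<in> w2_span UNIV" for n m
      using basis_v_in_w2_span[of "Suc m" UNIV n] by (simp add: basis_v_def mult.left_commute)
    with w2 show ?case
      by (intro additive_w2_span[of f UNIV _ "(*) w2"] subspace_w2_span) (auto simp: distrib_left)
  qed (auto intro: M.subspace_0 M.subspace_add subspace_w2_span)
  then show ?thesis by blast
qed

text \<open>The hypothesis on I is what Sq^2 demands: its term (m + 1) v_{n,m+1} is nonzero only for
  even m, and every other term keeps the exponent m.\<close>

lemma graded_A1_submodule_w2_span:
  assumes I: "\<And>m. m \<in> I \<Longrightarrow> even m \<Longrightarrow> Suc m \<in> I"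
  shows "graded_A1_submodule (w2_span I)"
proof -
  have mem: "of_nat k * basis_v n m \<in> w2_span I" if "m \<in> I" for k n m
    by (intro subspace_of_nat_mult subspace_w2_span basis_v_in_w2_span that)
  have "of_nat (Suc m) * basis_v n (Suc m) \<in> w2_span I" if "m \<in> I" for n m
  proof (cases "even m")
    case False
    \<comment> \<open>Here m is odd, so the coefficient m + 1 is even and vanishes in characteristic
      2.\<close>
    then obtain j where "Suc m = j + j" by (metis even_Suc evenE mult_2)
    then have "(of_nat (Suc m) :: S) = 0"
      using self_cancel_char2(1)[OF S_char2] by (simp only: of_nat_add)
    then show ?thesis by (simp add: M.subspace_0 subspace_w2_span del: of_nat_Suc)
  qed (use mem I that in blast)
  with mem have "Sq_M 1 (basis_v n m) \<in> w2_span I" "Sq_M 2 (basis_v n m) \<in> w2_span I"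
    if "m \<in> I" for n m
    unfolding Sq_M_basis_v using that M.subspace_add[OF subspace_w2_span] by blast+
  then have "Sq_M 1 f \<in> w2_span I" "Sq_M 2 f \<in> w2_span I" if "f \<in> w2_span I" for f
    using additive_w2_span[of f I "w2_span I" "Sq_M 1"] additive_w2_span[of f I "w2_span I" "Sq_M 2"]
      that subspace_w2_span Sq_M_zero Sq_M_add by blast+
  then have "A1_submodule (w2_span I)"
    by (intro A1_submoduleI subspace_w2_span)
  moreover have "homogeneous_part d f \<in> w2_span I" if "f \<in> w2_span I" for d f
  proof -
    \<comment> \<open>Each summand of a homogeneous part is a multiple of a basis vector, and its
      coefficient is zero unless m lies in I.\<close>
    have "scale_M (coeff (coeff f m) n) (basis_v n m) \<in> w2_span I" for n m
      using coeff_w2_span[OF that, of m] basis_v_in_w2_span[of m I n]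
      by (cases "m \<in> I") (simp_all add: M.subspace_scale M.subspace_0 subspace_w2_span)
    then show ?thesis
      unfolding homogeneous_part_def by (intro M.subspace_sum[OF subspace_w2_span]) auto
  qed
  ultimately show ?thesis by (simp add: graded_A1_submodule_def)
qed

lemma w2_span_Int:
  assumes "I \<inter> J = {}"
  shows "w2_span I \<inter> w2_span J = {0}"
proof -
  have "f = 0" if "f \<in> w2_span I" "f \<in> w2_span J" for f
  proof (rule poly_eqI)
    fix m
    from assms have "m \<notin> I \<or> m \<notin> J" by blast
    with that show "coeff f m = coeff 0 m"
      using coeff_w2_span by auto
  qed
  then show ?thesis using M.subspace_0[OF subspace_w2_span] by blast
qed

lemma w2_span_Un: "w2_span (I \<union> J) = {f + g | f g. f \<in> w2_span I \<and> g \<in> w2_span J}"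
proof -
  have "{basis_v n m | n m. m \<in> I \<union> J} = {basis_v n m | n m. m \<in> I} \<union> {basis_v n m | n m. m \<in> J}"
    by auto
  then show ?thesis by (simp only: w2_span_def M.span_Un)
qed

lemma M01_eq_w2_span: "M01 = w2_span {m. m mod 4 = 0 \<or> m mod 4 = 1}"
  and M23_eq_w2_span: "M23 = w2_span {m. m mod 4 = 2 \<or> m mod 4 = 3}"
  by (simp_all add: M01_def M23_def w2_span_def)

theorem theorem7p2:
  shows "A1_submodule M01 \<and> A1_submodule M23 \<and> is_graded_A1_direct_sum M01 M23"
proof -
  \<comment> \<open>The even exponents allowed are 0, respectively 2, modulo 4, and their successors
    are allowed as well.\<close>
  have "graded_A1_submodule M01" "graded_A1_submodule M23"
    unfolding M01_eq_w2_span M23_eq_w2_span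
    by (rule graded_A1_submodule_w2_span; simp; presburger)+
  moreover have "M01 \<inter> M23 = {0}"
    unfolding M01_eq_w2_span M23_eq_w2_span by (rule w2_span_Int) auto
  moreover have "{m. m mod 4 = 0 \<or> m mod 4 = 1} \<union> {m. m mod 4 = 2 \<or> m mod 4 = 3} = (UNIV :: nat set)"
    by auto
  then have "{f + g | f g. f \<in> M01 \<and> g \<in> M23} = UNIV"
    unfolding M01_eq_w2_span M23_eq_w2_span w2_span_Un[symmetric] by (simp only: w2_span_UNIV)
  ultimately show ?thesis
    by (simp add: is_graded_A1_direct_sum_def graded_A1_submodule_def)
qed

end
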